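(* Let $A$ be a multigraded squarefree $s\times l$ matrix of uniform rank over $R=\Bbbk[x_1,\ldots,x_n]$, and suppose that $A$ is the presentation matrix of the $R$-module $M$. If $l<s$ then $\mathrm{ann}(M)=0$. Otherwise $\mathrm{ann}(M)=\sqrt{\mathrm{Fitt}_0(M)}$.
   Context: $\Bbbk$ is a field of characteristic $0$, $R=\Bbbk[x_1,\ldots,x_n]$, $x^\alpha=x_1^{a_1}\cdots x_n^{a_n}$ for $\alpha=(a_1,\dots,a_n)$. An $s\times l$ matrix $A=(c_{ij}x^{\alpha_{ij}})$ with $c_{ij}\in\Bbbk$, $\alpha_{ij}\in\mathbb N^n$ is multigraded if every minor of $A$ equals $c\,x^{\alpha}$ for some $c\in\Bbbk$ (possibly $0$) and some $\alpha\in\mathbb N^n$. It is of uniform rank if all of its minors (of all sizes) are nonzero. The system $E_A$ consists of the equations $\gamma_j-\beta_i=\alpha_{ij}$, one for each $(i,j)$ with $c_{ij}\ne0$, in the unknown vectors $\gamma_1,\ldots,\gamma_l,\beta_1,\ldots,\beta_s$. A multigraded matrix $A$ is squarefree if $E_A$ has a solution with all $\gamma_j,\beta_i\in\{0,1\}^n$. $A$ is the presentation matrix of $M$ means that there is an exact sequence $R^l\xrightarrow{\phi}R^s\to M\to0$ in which $\phi$ is represented by $A$. For $l\ge s$, $\mathrm{Fitt}_0(M)$ is the ideal of $R$ generated by the $s\times s$ minors of $A$. *)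

theory Defs
  imports
    "HOL-Algebra.Ideal"
    "HOL-Algebra.Module"
    "HOL-Library.Poly_Mapping"
    "Jordan_Normal_Form.Determinant"
    "Jordan_Normal_Form.DL_Submatrix"
begin

text \<open>
  Polynomials in countably many variables: a monomial is a finitely supported exponent function.
  The ring in the \<open>n\<close> variables \<open>x_1, ..., x_n\<close> is cut out below as a carrier set; the variables are
  numbered from \<open>0\<close> to \<open>n - 1\<close>.
\<close>

type_synonym 'k mpoly = "(nat \<Rightarrow>\<^sub>0 nat) \<Rightarrow>\<^sub>0 'k"

definition exponents :: "nat \<Rightarrow> (nat \<Rightarrow>\<^sub>0 nat) set"
  where "exponents n = {\<alpha>. Poly_Mapping.keys \<alpha> \<subseteq> {..<n}}"

definition mpoly_ring :: "nat \<Rightarrow> ('k::field_char_0) mpoly ring"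
  where "mpoly_ring n =
    \<lparr>carrier = {p. Poly_Mapping.keys p \<subseteq> exponents n},
     monoid.mult = (*), one = 1, zero = 0, add = (+)\<rparr>"

lemma mpoly_ring_cring: "cring (mpoly_ring n :: ('k::field_char_0) mpoly ring)"
proof -
  have times: "p * q \<in> carrier (mpoly_ring n)"
    if "p \<in> carrier (mpoly_ring n)" "q \<in> carrier (mpoly_ring n)" for p q :: "'k mpoly"
  proof -
    have "\<gamma> \<in> exponents n" if g: "\<gamma> \<in> Poly_Mapping.keys (p * q)" for \<gamma>
    proof -
      obtain \<alpha> \<beta> where "\<gamma> = \<alpha> + \<beta>" "\<alpha> \<in> Poly_Mapping.keys p" "\<beta> \<in> Poly_Mapping.keys q"
        using g Poly_Mapping.keys_mult[of p q] by blast
      moreover have "Poly_Mapping.keys (\<alpha> + \<beta>) \<subseteq> Poly_Mapping.keys \<alpha> \<union> Poly_Mapping.keys \<beta>"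
        by (rule Poly_Mapping.keys_add)
      ultimately show ?thesis
        using \<open>p \<in> _\<close> \<open>q \<in> _\<close> unfolding mpoly_ring_def exponents_def by auto
    qed
    then show ?thesis by (auto simp: mpoly_ring_def)
  qed
  have plus: "p + q \<in> carrier (mpoly_ring n)"
    if "p \<in> carrier (mpoly_ring n)" "q \<in> carrier (mpoly_ring n)" for p q :: "'k mpoly"
    using that Poly_Mapping.keys_add[of p q] by (auto simp: mpoly_ring_def)
  show ?thesis
  proof (rule cringI)
    show "abelian_group (mpoly_ring n :: 'k mpoly ring)"
    proof (rule abelian_groupI)
      fix x :: "'k mpoly" assume "x \<in> carrier (mpoly_ring n)"
      then show "\<exists>y\<in>carrier (mpoly_ring n). y \<oplus>\<^bsub>mpoly_ring n\<^esub> x = \<zero>\<^bsub>mpoly_ring n\<^esub>"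
        by (intro bexI[of _ "- x"]) (auto simp: mpoly_ring_def in_keys_iff subset_iff)
    qed (use plus in \<open>auto simp: mpoly_ring_def algebra_simps\<close>)
    show "comm_monoid (mpoly_ring n :: 'k mpoly ring)"
      by (rule comm_monoidI)
        (use times in \<open>auto simp: mpoly_ring_def algebra_simps exponents_def\<close>)
  qed (auto simp: mpoly_ring_def algebra_simps)
qed

text \<open>The free module \<open>R^m\<close>, as a set of column vectors.\<close>

definition free_vecs :: "nat \<Rightarrow> nat \<Rightarrow> ('k::field_char_0) mpoly vec set"
  where "free_vecs n m = {v \<in> carrier_vec m. \<forall>i<m. v $ i \<in> carrier (mpoly_ring n)}"

text \<open>
  A polynomial of the form \<open>c x^\<alpha>\<close>, where \<open>c = 0\<close> is allowed; if \<open>c \<noteq> 0\<close>, then \<open>c\<close> and \<open>\<alpha>\<close> are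
  determined by the polynomial.
\<close>

definition is_term :: "nat \<Rightarrow> ('k::field_char_0) mpoly \<Rightarrow> bool"
  where "is_term n p \<longleftrightarrow> (\<exists>c. \<exists>\<alpha>\<in>exponents n. p = Poly_Mapping.single \<alpha> c)"

text \<open>The case \<open>k = 0\<close> only contributes the empty minor \<open>1\<close>.\<close>

definition minors :: "nat \<Rightarrow> 'a::comm_ring_1 mat \<Rightarrow> 'a set"
  where "minors k A = {det (submatrix A I J) | I J.
    I \<subseteq> {..<dim_row A} \<and> J \<subseteq> {..<dim_col A} \<and> card I = k \<and> card J = k}"

definition multigraded :: "nat \<Rightarrow> ('k::field_char_0) mpoly mat \<Rightarrow> bool"
  where "multigraded n A \<longleftrightarrow>
    (\<forall>i<dim_row A. \<forall>j<dim_col A. is_term n (A $$ (i, j))) \<and>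
    (\<forall>k. \<forall>m\<in>minors k A. is_term n m)"

definition uniform_rank :: "'a::comm_ring_1 mat \<Rightarrow> bool"
  where "uniform_rank A \<longleftrightarrow> (\<forall>k. \<forall>m\<in>minors k A. m \<noteq> 0)"

text \<open>
  \<open>\<gamma> j\<close> and \<open>\<beta> i\<close> stand for the unknown vectors of the system \<open>E_A\<close>; of their values only those at the
  indices \<open>v < n\<close> matter. The equations are read over the integers.
\<close>

definition solves_E :: "nat \<Rightarrow> ('k::field_char_0) mpoly mat \<Rightarrow>
    (nat \<Rightarrow> nat \<Rightarrow> int) \<Rightarrow> (nat \<Rightarrow> nat \<Rightarrow> int) \<Rightarrow> bool"
  where "solves_E n A \<gamma> \<beta> \<longleftrightarrow>
    (\<forall>i<dim_row A. \<forall>j<dim_col A. \<forall>c \<alpha>. c \<noteq> 0 \<longrightarrow> A $$ (i, j) = Poly_Mapping.single \<alpha> c \<longrightarrow>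
      (\<forall>v<n. \<gamma> j v - \<beta> i v = int (Poly_Mapping.lookup \<alpha> v)))"

definition squarefree_matrix :: "nat \<Rightarrow> ('k::field_char_0) mpoly mat \<Rightarrow> bool"
  where "squarefree_matrix n A \<longleftrightarrow> (\<exists>\<gamma> \<beta>. solves_E n A \<gamma> \<beta> \<and>
    (\<forall>j<dim_col A. \<forall>v<n. \<gamma> j v \<in> {0, 1}) \<and>
    (\<forall>i<dim_row A. \<forall>v<n. \<beta> i v \<in> {0, 1}))"

text \<open>
  Exactness of \<open>R^l \<rightarrow> R^s \<rightarrow> M \<rightarrow> 0\<close>, where the first map is \<open>w \<mapsto> A w\<close> and the second is \<open>\<pi>\<close>.
\<close>

definition presentation_matrix ::
    "nat \<Rightarrow> ('k::field_char_0) mpoly mat \<Rightarrow> ('k mpoly, 'm) module \<Rightarrow> bool"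
  where "presentation_matrix n A M \<longleftrightarrow>
    (\<forall>i<dim_row A. \<forall>j<dim_col A. A $$ (i, j) \<in> carrier (mpoly_ring n)) \<and>
    (\<exists>\<pi>.
      \<pi> \<in> free_vecs n (dim_row A) \<rightarrow> carrier M \<and>
      (\<forall>v\<in>free_vecs n (dim_row A). \<forall>w\<in>free_vecs n (dim_row A). \<pi> (v + w) = \<pi> v \<oplus>\<^bsub>M\<^esub> \<pi> w) \<and>
      (\<forall>r\<in>carrier (mpoly_ring n). \<forall>v\<in>free_vecs n (dim_row A). \<pi> (r \<cdot>\<^sub>v v) = r \<odot>\<^bsub>M\<^esub> \<pi> v) \<and>
      \<pi> ` free_vecs n (dim_row A) = carrier M \<and>
      {v \<in> free_vecs n (dim_row A). \<pi> v = \<zero>\<^bsub>M\<^esub>} = (\<lambda>w. A *\<^sub>v w) ` free_vecs n (dim_col A))"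

definition annihilator :: "'r ring \<Rightarrow> ('r, 'm) module \<Rightarrow> 'r set"
  where "annihilator R M = {r \<in> carrier R. \<forall>m\<in>carrier M. r \<odot>\<^bsub>M\<^esub> m = \<zero>\<^bsub>M\<^esub>}"

definition radical :: "'r ring \<Rightarrow> 'r set \<Rightarrow> 'r set"
  where "radical R I = {r \<in> carrier R. \<exists>m::nat. m > 0 \<and> r [^]\<^bsub>R\<^esub> m \<in> I}"

text \<open>The zeroth Fitting ideal of the module presented by \<open>A\<close>, when \<open>A\<close> has at least as many columns as rows.\<close>

definition Fitt0 :: "nat \<Rightarrow> ('k::field_char_0) mpoly mat \<Rightarrow> 'k mpoly set"
  where "Fitt0 n A = Idl\<^bsub>mpoly_ring n\<^esub> (minors (dim_row A) A)"

end

theory Submission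
  imports Defs
begin

text \<open>
  An element \<open>r\<close> annihilates \<open>M\<close> iff \<open>A W = r 1\<close> for some matrix \<open>W\<close> over \<open>R\<close>. Taking determinants and
  expanding along the columns of \<open>A\<close>, as in the Cauchy-Binet formula, \<open>r^s\<close> is a combination of maximal
  minors; it vanishes if \<open>l < s\<close>. Conversely, let \<open>p\<close> have a power in the monomial ideal \<open>Fitt0\<close>.
  Setting to \<open>0\<close> the variables outside the support of a term \<open>x^\<alpha>\<close> of \<open>p\<close> is a ring homomorphism into a
  domain, so some maximal minor of \<open>A\<close> has all its variables in the support of \<open>\<alpha>\<close>. If \<open>f\<close> selects its
  columns, write \<open>x^(\<beta> i) A (i, j) = c i j x^(\<gamma> j)\<close> and let \<open>D\<close> be the inverse of the scalar
  matrix \<open>c i (f k)\<close>. Then \<open>A W = x^\<alpha> 1\<close> is solved by \<open>W (f k, i) = D (k, i) x^(\<alpha> + \<beta> i - \<gamma> (f k))\<close>. Since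
  \<open>\<beta>\<close> and \<open>\<gamma>\<close> are 0-1 vectors and \<open>\<beta> i \<le> \<gamma> j\<close>, a variable with \<open>\<gamma> (f k) - \<beta> i = 1\<close> occurs in the minor,
  hence in \<open>x^\<alpha>\<close>, and so these exponents are nonnegative.
\<close>

section \<open>Column selections, maximal minors and the Cauchy-Binet expansion\<close>

text \<open>A minor lists its columns in increasing order, whereas \<open>f\<close> may list them in
  any order. Sorting the columns is a permutation, which costs only a sign.\<close>

lemma det_select_cols_minor:
  fixes A :: "'a::comm_ring_1 mat"
  assumes A: "A \<in> carrier_mat s l" and f: "f ` {0..<s} \<subseteq> {0..<l}" and inj: "inj_on f {0..<s}"
  shows "\<exists>m \<in> minors s A. \<exists>\<epsilon> \<in> {1, - 1}. det (mat s s (\<lambda>(i, k). A $$ (i, f k))) = \<epsilon> * m"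
proof -
  define J where "J = f ` {0..<s}"
  define B where "B = submatrix A {..<s} J"
  \<comment> \<open>The position of \<open>f k\<close> in the increasing enumeration of
    \<open>J\<close>, continued by the identity so that \<open>p\<close> is a permutation in the
    sense of \<open>permutes\<close>.\<close>
  define p where "p k = (if k < s then card {a \<in> J. a < f k} else k)" for k
  have cJ: "card J = s" and finJ: "finite J" using inj by (auto simp: J_def card_image)
  have rows: "{i. i < dim_row A \<and> i < s} = {..<s}"
    and cols: "{j. j < dim_col A \<and> j \<in> J} = J" using A f by (auto simp: J_def)
  have pick_id: "pick {..<s} i = i" if "i < s" for i
  proof -
    have "{a \<in> {..<s}. a < i} = {..<i}" using that by auto
    then show ?thesis using pick_card_in_set[of i "{..<s}"] that by simp
  qed
  have pick_p: "pick J (p k) = f k" if "k < s" for k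
    using pick_card_in_set[of "f k" J] that by (auto simp: p_def J_def)
  have p_less: "p k < s" if "k < s" for k
  proof -
    have "{a \<in> J. a < f k} \<subset> J" using that by (auto simp: J_def)
    then show ?thesis using psubset_card_mono[OF finJ, of "{a \<in> J. a < f k}"] that by (simp add: p_def cJ)
  qed
  have "inj_on p {0..<s}"
  proof (rule inj_onI)
    fix a b assume ab: "a \<in> {0..<s}" "b \<in> {0..<s}" "p a = p b"
    then have "f a = f b" using pick_p[of a] pick_p[of b] by simp
    then show "a = b" using inj ab by (auto dest: inj_onD)
  qed
  then have perm: "p permutes {0..<s}"
    using p_less by (intro inj_on_nat_permutes) (auto simp: p_def)
  have B: "B \<in> carrier_mat s s"
    unfolding B_def carrier_mat_def by (simp add: dim_submatrix rows cols cJ)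
  have B_index: "B $$ (i, p k) = A $$ (i, f k)" if "i < s" "k < s" for i k
  proof -
    have "B $$ (i, p k) = A $$ (pick {..<s} i, pick J (p k))"
      unfolding B_def by (rule submatrix_index) (use that p_less[of k] in \<open>simp_all add: rows cols cJ\<close>)
    then show ?thesis using that pick_p[of k] pick_id[of i] by simp
  qed
  \<comment> \<open>Transposition turns the permuted columns into permuted rows, the form that
    \<open>det_permute_rows\<close> handles.\<close>
  have "det (mat s s (\<lambda>(i, k). A $$ (i, f k))) = det (mat s s (\<lambda>(k, i). B\<^sup>T $$ (p k, i)))"
  proof -
    have "(mat s s (\<lambda>(i, k). A $$ (i, f k)))\<^sup>T = mat s s (\<lambda>(k, i). B\<^sup>T $$ (p k, i))"
    proof (rule eq_matI)
      fix k i assume "k < dim_row (mat s s (\<lambda>(k, i). B\<^sup>T $$ (p k, i)))" "i < dim_col (mat s s (\<lambda>(k, i). B\<^sup>T $$ (p k, i)))"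
      then have "k < s" "i < s" by simp_all
      then show "(mat s s (\<lambda>(i, k). A $$ (i, f k)))\<^sup>T $$ (k, i) = mat s s (\<lambda>(k, i). B\<^sup>T $$ (p k, i)) $$ (k, i)"
        using B p_less[of k] B_index[of i k] by simp
    qed simp_all
    then show ?thesis
      using det_transpose[of "mat s s (\<lambda>(i, k). A $$ (i, f k))" s] by simp
  qed
  also have "\<dots> = signof p * det B"
    using det_permute_rows[OF transpose_carrier_mat[THEN iffD2, OF B] perm] det_transpose[OF B] by simp
  finally have eq: "det (mat s s (\<lambda>(i, k). A $$ (i, f k))) = signof p * det B" .
  have "det B \<in> minors s A"
    unfolding minors_def B_def using A f cJ by (intro CollectI exI[of _ "{..<s}"] exI[of _ J]) (simp add: J_def atLeast0LessThan)
  moreover have "(signof p :: 'a) \<in> {1, - 1}" by (simp add: sign_def)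
  ultimately show ?thesis using eq by (intro bexI[of _ "det B"] bexI[of _ "signof p"])
qed

text \<open>Column \<open>k\<close> of \<open>A * W\<close> is the combination of the columns of
  \<open>A\<close> with coefficients \<open>W $$ (j, k)\<close>, and the determinant is multilinear.
  This is the Cauchy-Binet formula before the terms are grouped by the image of \<open>f\<close>.
  Fixing \<open>f k = k\<close> outside \<open>{0..<s}\<close> makes each selection occur exactly
  once.\<close>

lemma det_mult_expand_columns:
  fixes A W :: "'a::comm_ring_1 mat"
  assumes A: "A \<in> carrier_mat s l" and W: "W \<in> carrier_mat l s"
  shows "det (A * W) =
    (\<Sum>f | (\<forall>k\<in>{0..<s}. f k \<in> {0..<l}) \<and> (\<forall>k. k \<notin> {0..<s} \<longrightarrow> f k = k).
      (\<Prod>k=0..<s. W $$ (f k, k)) * det (mat s s (\<lambda>(i, k). A $$ (i, f k))))"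
proof -
  have AW: "A * W \<in> carrier_mat s s" using A W by simp
  have "det (A * W) = det (W\<^sup>T * A\<^sup>T)"
    using det_transpose[OF AW] transpose_mult[OF A W] by simp
  also have "W\<^sup>T * A\<^sup>T =
      mat\<^sub>r s s (\<lambda>k. finsum_vec TYPE('a) s (\<lambda>j. W $$ (j, k) \<cdot>\<^sub>v col A j) {0..<l})"
    using A W
    by (intro eq_matI) (auto simp: index_finsum_vec scalar_prod_def intro!: sum.cong)
  also have "det \<dots> = (\<Sum>f | (\<forall>k\<in>{0..<s}. f k \<in> {0..<l}) \<and> (\<forall>k. k \<notin> {0..<s} \<longrightarrow> f k = k).
      det (mat\<^sub>r s s (\<lambda>k. W $$ (f k, k) \<cdot>\<^sub>v col A (f k))))"
    using A by (intro det_linear_rows_sum) auto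
  also have "\<dots> = (\<Sum>f | (\<forall>k\<in>{0..<s}. f k \<in> {0..<l}) \<and> (\<forall>k. k \<notin> {0..<s} \<longrightarrow> f k = k).
      (\<Prod>k=0..<s. W $$ (f k, k)) * det (mat s s (\<lambda>(i, k). A $$ (i, f k))))"
  proof (intro sum.cong refl)
    fix f assume f: "f \<in> {f. (\<forall>k\<in>{0..<s}. f k \<in> {0..<l}) \<and> (\<forall>k. k \<notin> {0..<s} \<longrightarrow> f k = k)}"
    have "mat\<^sub>r s s (\<lambda>k. col A (f k)) = (mat s s (\<lambda>(i, k). A $$ (i, f k)))\<^sup>T"
      using f A by (intro eq_matI) auto
    then have "det (mat\<^sub>r s s (\<lambda>k. col A (f k))) = det (mat s s (\<lambda>(i, k). A $$ (i, f k)))"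
      using det_transpose[of "mat s s (\<lambda>(i, k). A $$ (i, f k))" s] by simp
    then show "det (mat\<^sub>r s s (\<lambda>k. W $$ (f k, k) \<cdot>\<^sub>v col A (f k))) =
        (\<Prod>k=0..<s. W $$ (f k, k)) * det (mat s s (\<lambda>(i, k). A $$ (i, f k)))"
      using A by (subst det_rows_mul) auto
  qed
  finally show ?thesis .
qed

lemma det_noninjective_columns:
  fixes A :: "'a::comm_ring_1 mat"
  assumes "\<not> inj_on f {0..<s}"
  shows "det (mat s s (\<lambda>(i, k). A $$ (i, f k))) = 0"
proof -
  obtain a b where ab: "a \<noteq> b" "a < s" "b < s" "f a = f b"
    using assms by (auto simp: inj_on_def)
  show ?thesis
    by (rule det_identical_columns[OF _ ab(1-3)]) (use ab in \<open>auto intro!: eq_vecI\<close>)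
qed

section \<open>Discarding monomials as a ring homomorphism\<close>

lemma sum_single_keys: "(\<Sum>k\<in>Poly_Mapping.keys p. Poly_Mapping.single k (Poly_Mapping.lookup p k)) = p"
proof (rule poly_mapping_eqI)
  fix k
  show "Poly_Mapping.lookup (\<Sum>k\<in>Poly_Mapping.keys p. Poly_Mapping.single k (Poly_Mapping.lookup p k)) k
    = Poly_Mapping.lookup p k"
    by (cases "k \<in> Poly_Mapping.keys p")
      (simp_all add: lookup_sum lookup_single when_def in_keys_iff)
qed

text \<open>The linear projection onto the span of the monomials in \<open>T\<close>. If
  \<open>T\<close> consists of all monomials in certain variables, this is the substitution of 0 for
  the other variables.\<close>

definition restrict_to :: "(nat \<Rightarrow>\<^sub>0 nat) set \<Rightarrow> ('k::field_char_0) mpoly \<Rightarrow> 'k mpoly"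
  where "restrict_to T = Poly_Mapping.mapp (\<lambda>\<alpha> c. c when \<alpha> \<in> T)"

lemma lookup_restrict_to:
  "Poly_Mapping.lookup (restrict_to T p) \<alpha> = (Poly_Mapping.lookup p \<alpha> when \<alpha> \<in> T)"
  by (auto simp: restrict_to_def lookup_mapp when_def in_keys_iff)

lemma restrict_to_zero [simp]: "restrict_to T 0 = 0"
  by (rule poly_mapping_eqI) (simp add: lookup_restrict_to)

lemma restrict_to_add: "restrict_to T (p + q) = restrict_to T p + restrict_to T q"
  by (rule poly_mapping_eqI) (simp add: lookup_restrict_to lookup_add when_add_distrib)

lemma restrict_to_sum: "restrict_to T (sum g F) = (\<Sum>x\<in>F. restrict_to T (g x))"
  by (induction F rule: infinite_finite_induct) (simp_all add: restrict_to_add)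

lemma restrict_to_single:
  "restrict_to T (Poly_Mapping.single \<alpha> c) = (if \<alpha> \<in> T then Poly_Mapping.single \<alpha> c else 0)"
  by (rule poly_mapping_eqI) (simp add: lookup_restrict_to lookup_single when_def)

text \<open>The condition says that \<open>T\<close> is closed under products and under divisors of
  monomials. A product of two terms therefore survives exactly if both factors do, and the claim
  follows by expanding into terms.\<close>

lemma restrict_to_mult:
  assumes T: "\<And>\<alpha> \<beta>. \<alpha> + \<beta> \<in> T \<longleftrightarrow> \<alpha> \<in> T \<and> \<beta> \<in> T"
  shows "restrict_to T (p * q) = restrict_to T p * restrict_to T q"
proof -
  let ?t = "\<lambda>p \<alpha>. Poly_Mapping.single \<alpha> (Poly_Mapping.lookup p \<alpha>)"
  have "restrict_to T (p * q) =
      restrict_to T ((\<Sum>\<alpha>\<in>Poly_Mapping.keys p. ?t p \<alpha>) * (\<Sum>\<beta>\<in>Poly_Mapping.keys q. ?t q \<beta>))"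
    by (simp add: sum_single_keys)
  also have "\<dots> = restrict_to T (\<Sum>\<alpha>\<in>Poly_Mapping.keys p. ?t p \<alpha>) *
      restrict_to T (\<Sum>\<beta>\<in>Poly_Mapping.keys q. ?t q \<beta>)"
    unfolding sum_product restrict_to_sum mult_single restrict_to_single
    by (intro sum.cong refl) (auto simp: T mult_single)
  finally show ?thesis by (simp add: sum_single_keys)
qed

text \<open>The condition on \<open>T\<close> also holds for the empty set; \<open>0 \<in> T\<close>
  secures that the constant 1 is preserved.\<close>

lemma restrict_to_power:
  assumes "\<And>\<alpha> \<beta>. \<alpha> + \<beta> \<in> T \<longleftrightarrow> \<alpha> \<in> T \<and> \<beta> \<in> T" and "0 \<in> T"
  shows "restrict_to T (p ^ m) = restrict_to T p ^ m"
proof (induction m)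
  case 0
  show ?case using assms(2) restrict_to_single[of T 0 1] by simp
qed (simp add: restrict_to_mult[OF assms(1)])

section \<open>Closure properties and ideals of the ring in n variables\<close>

lemma carrier_mpoly_ring_iff: "p \<in> carrier (mpoly_ring n) \<longleftrightarrow> Poly_Mapping.keys p \<subseteq> exponents n"
  by (simp add: mpoly_ring_def)

lemma mpoly_ring_simps [simp]:
  "\<zero>\<^bsub>mpoly_ring n\<^esub> = 0" "\<one>\<^bsub>mpoly_ring n\<^esub> = 1"
  "p \<oplus>\<^bsub>mpoly_ring n\<^esub> q = p + q" "p \<otimes>\<^bsub>mpoly_ring n\<^esub> q = p * q"
  by (simp_all add: mpoly_ring_def)

lemma mpoly_ring_pow [simp]: "p [^]\<^bsub>mpoly_ring n\<^esub> (m::nat) = p ^ m"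
proof (induction m)
  case 0
  interpret cring "mpoly_ring n :: 'a mpoly ring" by (rule mpoly_ring_cring)
  show ?case by (simp add: nat_pow_0)
next
  case (Suc m)
  interpret cring "mpoly_ring n :: 'a mpoly ring" by (rule mpoly_ring_cring)
  from Suc show ?case by (simp add: nat_pow_Suc mult.commute)
qed

lemma mpoly_ring_closed:
  fixes p q :: "('k::field_char_0) mpoly"
  shows "0 \<in> carrier (mpoly_ring n :: 'k mpoly ring)" "1 \<in> carrier (mpoly_ring n :: 'k mpoly ring)"
    and "p \<in> carrier (mpoly_ring n) \<Longrightarrow> q \<in> carrier (mpoly_ring n) \<Longrightarrow> p + q \<in> carrier (mpoly_ring n)"
    and "p \<in> carrier (mpoly_ring n) \<Longrightarrow> q \<in> carrier (mpoly_ring n) \<Longrightarrow> p * q \<in> carrier (mpoly_ring n)"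
    and "p \<in> carrier (mpoly_ring n) \<Longrightarrow> - p \<in> carrier (mpoly_ring n)"
proof -
  interpret cring "mpoly_ring n :: 'k mpoly ring" by (rule mpoly_ring_cring)
  show "0 \<in> carrier (mpoly_ring n :: 'k mpoly ring)" "1 \<in> carrier (mpoly_ring n :: 'k mpoly ring)"
    using zero_closed one_closed by simp_all
  show "p \<in> carrier (mpoly_ring n) \<Longrightarrow> q \<in> carrier (mpoly_ring n) \<Longrightarrow> p + q \<in> carrier (mpoly_ring n)"
    using a_closed[of p q] by simp
  show "p \<in> carrier (mpoly_ring n) \<Longrightarrow> q \<in> carrier (mpoly_ring n) \<Longrightarrow> p * q \<in> carrier (mpoly_ring n)"
    using m_closed[of p q] by simp
  show "p \<in> carrier (mpoly_ring n) \<Longrightarrow> - p \<in> carrier (mpoly_ring n)"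
    by (auto simp: carrier_mpoly_ring_iff in_keys_iff subset_iff)
qed

lemma mpoly_ring_sum_closed:
  assumes "\<And>x. x \<in> F \<Longrightarrow> g x \<in> carrier (mpoly_ring n)"
  shows "sum g F \<in> carrier (mpoly_ring n)"
  using assms by (induction F rule: infinite_finite_induct) (auto intro: mpoly_ring_closed)

lemma mpoly_ring_prod_closed:
  assumes "\<And>x. x \<in> F \<Longrightarrow> g x \<in> carrier (mpoly_ring n)"
  shows "prod g F \<in> carrier (mpoly_ring n)"
  using assms by (induction F rule: infinite_finite_induct) (auto intro: mpoly_ring_closed)

lemma mpoly_ring_single_closed: "\<alpha> \<in> exponents n \<Longrightarrow> Poly_Mapping.single \<alpha> c \<in> carrier (mpoly_ring n)"
  by (auto simp: carrier_mpoly_ring_iff split: if_splits)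

text \<open>Being an ideal, the kernel contains \<open>Fitt0 n A\<close> as soon as it contains the
  maximal minors.\<close>

lemma restrict_to_kernel_ideal:
  assumes T: "\<And>\<alpha> \<beta>. \<alpha> + \<beta> \<in> T \<longleftrightarrow> \<alpha> \<in> T \<and> \<beta> \<in> T"
  shows "ideal {p \<in> carrier (mpoly_ring n). restrict_to T p = (0 :: ('k::field_char_0) mpoly)}
    (mpoly_ring n)" (is "ideal ?I ?R")
proof -
  interpret cring ?R by (rule mpoly_ring_cring)
  have neg: "\<ominus>\<^bsub>?R\<^esub> p = - p" if "p \<in> carrier ?R" for p
    using that minus_equality[of "- p" p] by (simp add: mpoly_ring_closed)
  show ?thesis
  proof (rule idealI)
    show "ring ?R" by (rule ring_axioms)
    show "subgroup ?I (add_monoid ?R)"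
    proof (rule add.subgroupI)
      fix p assume p: "p \<in> ?I"
      have "restrict_to T (- p) = restrict_to T (- p) + restrict_to T p" using p by simp
      also have "\<dots> = 0" by (simp flip: restrict_to_add)
      finally show "\<ominus>\<^bsub>?R\<^esub> p \<in> ?I"
        using p neg[of p] by (simp add: mpoly_ring_closed)
    next
      show "?I \<noteq> {}" using mpoly_ring_closed(1)[where 'k = 'k] by fastforce
    next
      fix p q assume "p \<in> ?I" "q \<in> ?I"
      then show "p \<oplus>\<^bsub>?R\<^esub> q \<in> ?I" by (simp add: restrict_to_add mpoly_ring_closed)
    qed auto
  next
    fix p q assume "p \<in> ?I" "q \<in> carrier ?R"
    then show "q \<otimes>\<^bsub>?R\<^esub> p \<in> ?I" "p \<otimes>\<^bsub>?R\<^esub> q \<in> ?I"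
      by (simp_all add: restrict_to_mult[OF T] mpoly_ring_closed)
  qed
qed

section \<open>Solving \<open>A * W = r 1\<close> over the polynomial ring\<close>

text \<open>Up to the row factors x^(\<beta> i) and the column factors x^(\<gamma> j), the selected
  columns form the scalar matrix \<open>c i (f k)\<close>, which is invertible over the field. Its
  inverse, with these factors restored, solves the equation; \<open>le\<close> keeps the exponents
  nonnegative.\<close>

lemma monomial_multiple_of_identity:
  fixes A :: "('k::field_char_0) mpoly mat"
  assumes A: "A \<in> carrier_mat s l"
    and graded: "\<And>i j. i < s \<Longrightarrow> j < l \<Longrightarrow>
      Poly_Mapping.single (\<beta> i) 1 * A $$ (i, j) = Poly_Mapping.single (\<gamma> j) (c i j)"
    and f: "f ` {0..<s} \<subseteq> {0..<l}" and inj: "inj_on f {0..<s}"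
    and det: "det (mat s s (\<lambda>(i, k). c i (f k))) \<noteq> 0"
    and le: "\<And>i k v. i < s \<Longrightarrow> k < s \<Longrightarrow> Poly_Mapping.lookup (\<gamma> (f k)) v \<le>
      Poly_Mapping.lookup \<alpha> v + Poly_Mapping.lookup (\<beta> i) v"
    and \<alpha>: "\<alpha> \<in> exponents n" and \<beta>: "\<And>i. i < s \<Longrightarrow> \<beta> i \<in> exponents n"
  shows "\<exists>W \<in> carrier_mat l s. (\<forall>j<l. \<forall>i<s. W $$ (j, i) \<in> carrier (mpoly_ring n)) \<and>
    A * W = Poly_Mapping.single \<alpha> 1 \<cdot>\<^sub>m 1\<^sub>m s"
proof -
  define C where "C = mat s s (\<lambda>(i, k). c i (f k))"
  define D where "D = inverse (det C) \<cdot>\<^sub>m adj_mat C"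
  define h where "h j = inv_into {0..<s} f j" for j
  \<comment> \<open>Rows of \<open>W\<close> that belong to unselected columns of \<open>A\<close>
    are zero. The subtraction of exponents is truncated at 0; \<open>cancel\<close> shows that
    nothing is cut off in the selected rows.\<close>
  define W where "W = mat l s (\<lambda>(j, i). if j \<in> f ` {0..<s}
    then Poly_Mapping.single (\<alpha> + \<beta> i - \<gamma> j) (D $$ (h j, i)) else 0)"
  have C: "C \<in> carrier_mat s s" by (simp add: C_def)
  have D: "D \<in> carrier_mat s s" using adj_mat(1)[OF C] by (simp add: D_def)
  have CD: "C * D = 1\<^sub>m s"
    using det adj_mat(1,2)[OF C] unfolding D_def C_def[symmetric]
    by (subst mult_smult_distrib[OF C]) (auto intro!: eq_matI)
  have h: "h (f k) = k" if "k < s" for k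
    using inj that by (simp add: h_def)
  have W: "W \<in> carrier_mat l s" by (simp add: W_def)
  have cancel: "\<gamma> (f k) + (\<alpha> + \<beta> i - \<gamma> (f k)) = \<alpha> + \<beta> i" if "i < s" "k < s" for i k
    using le[OF that] by (intro poly_mapping_eqI) (simp add: lookup_add lookup_minus)
  have W_closed: "W $$ (j, i) \<in> carrier (mpoly_ring n)" if ij: "j < l" "i < s" for i j
  proof -
    have "\<alpha> + \<beta> i - \<gamma> j \<in> exponents n"
    proof -
      have "Poly_Mapping.keys (\<alpha> + \<beta> i - \<gamma> j) \<subseteq> Poly_Mapping.keys \<alpha> \<union> Poly_Mapping.keys (\<beta> i)"
        by (auto simp: in_keys_iff lookup_add lookup_minus)
      then show ?thesis using \<alpha> \<beta>[OF ij(2)] by (auto simp: exponents_def)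
    qed
    then show ?thesis using ij
      by (auto simp: W_def mpoly_ring_single_closed mpoly_ring_closed)
  qed
  have "(A * W) $$ (i', i) = Poly_Mapping.single \<alpha> 1 * (if i' = i then 1 else 0)"
    if ii: "i' < s" "i < s" for i' i
  proof -
    \<comment> \<open>The entry is computed after multiplication by x^(\<beta> i'), where
      \<open>graded\<close> applies and every summand has the same exponent \<alpha> + \<beta>
      i.\<close>
    have "Poly_Mapping.single (\<beta> i') 1 * (A * W) $$ (i', i) =
        (\<Sum>j\<in>{0..<l}. Poly_Mapping.single (\<beta> i') 1 * A $$ (i', j) * W $$ (j, i))"
      using A W ii by (simp add: scalar_prod_def sum_distrib_left mult.assoc)
    also have "\<dots> = (\<Sum>j\<in>{0..<l}. Poly_Mapping.single (\<gamma> j) (c i' j) * W $$ (j, i))"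
      using graded ii by (intro sum.cong) auto
    also have "\<dots> = (\<Sum>j\<in>f ` {0..<s}. Poly_Mapping.single (\<gamma> j) (c i' j) * W $$ (j, i))"
      using f ii by (intro sum.mono_neutral_right) (auto simp: W_def)
    also have "\<dots> = (\<Sum>k\<in>{0..<s}. Poly_Mapping.single (\<gamma> (f k)) (c i' (f k)) * W $$ (f k, i))"
      using inj by (simp add: sum.reindex)
    also have "\<dots> = (\<Sum>k\<in>{0..<s}. Poly_Mapping.single (\<alpha> + \<beta> i) (C $$ (i', k) * D $$ (k, i)))"
    proof (intro sum.cong refl)
      fix k assume "k \<in> {0..<s}"
      then have k: "k < s" "f k < l" using f by (auto simp: image_subset_iff)
      show "Poly_Mapping.single (\<gamma> (f k)) (c i' (f k)) * W $$ (f k, i) =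
          Poly_Mapping.single (\<alpha> + \<beta> i) (C $$ (i', k) * D $$ (k, i))"
        using k ii cancel[OF ii(2) k(1)] by (simp add: W_def C_def h mult_single)
    qed
    also have "\<dots> = Poly_Mapping.single (\<alpha> + \<beta> i) (\<Sum>k\<in>{0..<s}. C $$ (i', k) * D $$ (k, i))"
      by (intro poly_mapping_eqI) (simp add: lookup_sum lookup_single when_def)
    also have "(\<Sum>k\<in>{0..<s}. C $$ (i', k) * D $$ (k, i)) = (C * D) $$ (i', i)"
      using C D ii by (simp add: scalar_prod_def)
    also have "Poly_Mapping.single (\<alpha> + \<beta> i) ((C * D) $$ (i', i)) =
        Poly_Mapping.single (\<beta> i') 1 * (Poly_Mapping.single \<alpha> 1 * (if i' = i then 1 else 0))"
      using ii by (simp add: CD mult_single add.commute)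
    \<comment> \<open>The factor x^(\<beta> i') is nonzero, so it cancels in the integral domain of
      polynomials.\<close>
    finally show ?thesis
      by (simp flip: keys_eq_empty)
  qed
  then have "A * W = Poly_Mapping.single \<alpha> 1 \<cdot>\<^sub>m 1\<^sub>m s"
    using A W by (intro eq_matI) auto
  with W W_closed show ?thesis by blast
qed

text \<open>The equation is linear in \<open>W\<close> and \<open>r\<close> together, so solutions
  for the monomials of \<open>p\<close> add up, weighted by the coefficients of \<open>p\<close> as
  constant polynomials.\<close>

lemma multiple_of_identity_from_monomials:
  fixes A :: "('k::field_char_0) mpoly mat"
  assumes A: "A \<in> carrier_mat s l" and p: "p \<in> carrier (mpoly_ring n)"
    and mono: "\<And>\<alpha>. \<alpha> \<in> Poly_Mapping.keys p \<Longrightarrow>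
      \<exists>W \<in> carrier_mat l s. (\<forall>j<l. \<forall>i<s. W $$ (j, i) \<in> carrier (mpoly_ring n)) \<and>
        A * W = Poly_Mapping.single \<alpha> 1 \<cdot>\<^sub>m 1\<^sub>m s"
  shows "\<exists>W \<in> carrier_mat l s. (\<forall>j<l. \<forall>i<s. W $$ (j, i) \<in> carrier (mpoly_ring n)) \<and>
    A * W = p \<cdot>\<^sub>m 1\<^sub>m s"
proof -
  let ?c = "\<lambda>\<alpha>. Poly_Mapping.single 0 (Poly_Mapping.lookup p \<alpha>)"
  obtain V where V: "\<And>\<alpha>. \<alpha> \<in> Poly_Mapping.keys p \<Longrightarrow> V \<alpha> \<in> carrier_mat l s"
      "\<And>\<alpha> j i. \<alpha> \<in> Poly_Mapping.keys p \<Longrightarrow> j < l \<Longrightarrow> i < s \<Longrightarrow> V \<alpha> $$ (j, i) \<in> carrier (mpoly_ring n)"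
      "\<And>\<alpha>. \<alpha> \<in> Poly_Mapping.keys p \<Longrightarrow> A * V \<alpha> = Poly_Mapping.single \<alpha> 1 \<cdot>\<^sub>m 1\<^sub>m s"
    using mono by metis
  define W where "W = mat l s (\<lambda>(j, i). \<Sum>\<alpha>\<in>Poly_Mapping.keys p. ?c \<alpha> * V \<alpha> $$ (j, i))"
  have W: "W \<in> carrier_mat l s" by (simp add: W_def)
  have "W $$ (j, i) \<in> carrier (mpoly_ring n)" if "j < l" "i < s" for j i
    using that V(2)
    by (auto simp: W_def exponents_def intro!: mpoly_ring_sum_closed mpoly_ring_closed mpoly_ring_single_closed)
  moreover have "A * W = p \<cdot>\<^sub>m 1\<^sub>m s"
  proof (rule eq_matI)
    fix i' i assume "i' < dim_row (p \<cdot>\<^sub>m 1\<^sub>m s)" "i < dim_col (p \<cdot>\<^sub>m 1\<^sub>m s)"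
    then have ii: "i' < s" "i < s" by simp_all
    have "(A * W) $$ (i', i) = (\<Sum>j\<in>{0..<l}. A $$ (i', j) * (\<Sum>\<alpha>\<in>Poly_Mapping.keys p. ?c \<alpha> * V \<alpha> $$ (j, i)))"
      using A W ii by (simp add: scalar_prod_def) (simp add: W_def)
    also have "\<dots> = (\<Sum>\<alpha>\<in>Poly_Mapping.keys p. ?c \<alpha> * (\<Sum>j\<in>{0..<l}. A $$ (i', j) * V \<alpha> $$ (j, i)))"
      unfolding sum_distrib_left by (subst sum.swap) (simp add: mult.left_commute)
    also have "\<dots> = (\<Sum>\<alpha>\<in>Poly_Mapping.keys p. ?c \<alpha> * (A * V \<alpha>) $$ (i', i))"
      using A V(1) ii by (intro sum.cong refl) (auto simp: scalar_prod_def dest!: V(1))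
    also have "\<dots> = (\<Sum>\<alpha>\<in>Poly_Mapping.keys p. Poly_Mapping.single \<alpha> (Poly_Mapping.lookup p \<alpha>) * (if i' = i then 1 else 0))"
      using V(3) ii by (intro sum.cong refl) (simp add: mult_single)
    also have "\<dots> = p * (if i' = i then 1 else 0)"
      by (simp add: sum_single_keys flip: sum_distrib_right)
    finally show "(A * W) $$ (i', i) = (p \<cdot>\<^sub>m 1\<^sub>m s) $$ (i', i)" using ii by simp
  qed (use A W in auto)
  ultimately show ?thesis using W by blast
qed

section \<open>The annihilator in terms of a matrix equation\<close>

lemma mult_mat_vec_free_vecs:
  assumes A: "A \<in> carrier_mat s l" and "\<And>i j. i < s \<Longrightarrow> j < l \<Longrightarrow> A $$ (i, j) \<in> carrier (mpoly_ring n)"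
    and v: "v \<in> free_vecs n l"
  shows "A *\<^sub>v v \<in> free_vecs n s"
  using assms
  by (auto simp: free_vecs_def scalar_prod_def intro!: mpoly_ring_sum_closed mpoly_ring_closed(4))

text \<open>By surjectivity of \<open>\<pi>\<close>, \<open>r\<close> annihilates \<open>M\<close>
  iff \<open>r\<close> maps the free module into the kernel of \<open>\<pi>\<close>, which is the
  image of \<open>A\<close>. This can be tested on the unit vectors; preimages of
  \<open>r \<cdot>\<^sub>v unit_vec s i\<close> are the columns of \<open>W\<close>.\<close>

lemma annihilator_iff_multiple_of_identity:
  fixes A :: "('k::field_char_0) mpoly mat" and M :: "('k mpoly, 'm) module"
  assumes A: "A \<in> carrier_mat s l" and M: "module (mpoly_ring n) M"
    and pres: "presentation_matrix n A M"
  shows "r \<in> annihilator (mpoly_ring n) M \<longleftrightarrow> r \<in> carrier (mpoly_ring n) \<and>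
    (\<exists>W \<in> carrier_mat l s. (\<forall>j<l. \<forall>i<s. W $$ (j, i) \<in> carrier (mpoly_ring n)) \<and> A * W = r \<cdot>\<^sub>m 1\<^sub>m s)"
proof -
  have dims: "dim_row A = s" "dim_col A = l" using A by auto
  obtain \<pi> where
    closed: "\<pi> \<in> free_vecs n s \<rightarrow> carrier M"
    and smult: "\<And>r v. r \<in> carrier (mpoly_ring n) \<Longrightarrow> v \<in> free_vecs n s \<Longrightarrow> \<pi> (r \<cdot>\<^sub>v v) = r \<odot>\<^bsub>M\<^esub> \<pi> v"
    and surj: "\<pi> ` free_vecs n s = carrier M"
    and ker: "{v \<in> free_vecs n s. \<pi> v = \<zero>\<^bsub>M\<^esub>} = (\<lambda>w. A *\<^sub>v w) ` free_vecs n l"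
    using pres unfolding presentation_matrix_def dims by (elim conjE exE) (rule that, assumption, simp, assumption, assumption)
  have scaled: "r \<cdot>\<^sub>v v \<in> free_vecs n s" if "r \<in> carrier (mpoly_ring n)" "v \<in> free_vecs n s" for r v
    using that by (auto simp: free_vecs_def intro!: mpoly_ring_closed(4))
  show ?thesis
  proof (intro iffI conjI; (elim conjE bexE)?)
    assume r: "r \<in> annihilator (mpoly_ring n) M"
    then show rc: "r \<in> carrier (mpoly_ring n)" by (simp add: annihilator_def)
    have "\<exists>w \<in> free_vecs n l. A *\<^sub>v w = r \<cdot>\<^sub>v unit_vec s i" if i: "i < s" for i
    proof -
      have e: "unit_vec s i \<in> free_vecs n s"
        using i by (auto simp: free_vecs_def unit_vec_def mpoly_ring_closed)
      then have "\<pi> (r \<cdot>\<^sub>v unit_vec s i) = \<zero>\<^bsub>M\<^esub>"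
        using r closed smult[OF rc e] by (auto simp: annihilator_def)
      then have "r \<cdot>\<^sub>v unit_vec s i \<in> (\<lambda>w. A *\<^sub>v w) ` free_vecs n l"
        using scaled[OF rc e] by (simp flip: ker)
      then show ?thesis by force
    qed
    then obtain w where w: "\<And>i. i < s \<Longrightarrow> w i \<in> free_vecs n l" "\<And>i. i < s \<Longrightarrow> A *\<^sub>v w i = r \<cdot>\<^sub>v unit_vec s i"
      by metis
    define W where "W = mat l s (\<lambda>(j, i). w i $ j)"
    have W: "W \<in> carrier_mat l s" by (simp add: W_def)
    have colW: "col W i = w i" if "i < s" for i
      using w(1)[OF that] that by (intro eq_vecI) (auto simp: W_def free_vecs_def)
    have "A * W = r \<cdot>\<^sub>m 1\<^sub>m s"
    proof (rule eq_matI)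
      fix i' i assume "i' < dim_row (r \<cdot>\<^sub>m 1\<^sub>m s)" "i < dim_col (r \<cdot>\<^sub>m 1\<^sub>m s)"
      then have ii: "i' < s" "i < s" by simp_all
      then have "(A * W) $$ (i', i) = (A *\<^sub>v w i) $ i'" using A W colW by simp
      then show "(A * W) $$ (i', i) = (r \<cdot>\<^sub>m 1\<^sub>m s) $$ (i', i)" using w(2) ii by simp
    qed (use A W in auto)
    moreover have "W $$ (j, i) \<in> carrier (mpoly_ring n)" if "j < l" "i < s" for i j
      using w(1) that by (auto simp: W_def free_vecs_def)
    ultimately show "\<exists>W \<in> carrier_mat l s. (\<forall>j<l. \<forall>i<s. W $$ (j, i) \<in> carrier (mpoly_ring n)) \<and>
        A * W = r \<cdot>\<^sub>m 1\<^sub>m s"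
      using W by blast
  next
    fix W assume rc: "r \<in> carrier (mpoly_ring n)" and W: "W \<in> carrier_mat l s"
      and Wc: "\<forall>j<l. \<forall>i<s. W $$ (j, i) \<in> carrier (mpoly_ring n)" and AW: "A * W = r \<cdot>\<^sub>m 1\<^sub>m s"
    have "r \<odot>\<^bsub>M\<^esub> m = \<zero>\<^bsub>M\<^esub>" if m: "m \<in> carrier M" for m
    proof -
      obtain v where v: "v \<in> free_vecs n s" "m = \<pi> v" using m[folded surj] by blast
      have "A *\<^sub>v (W *\<^sub>v v) = r \<cdot>\<^sub>v v"
        using A W v(1) by (subst assoc_mult_mat_vec[symmetric]) (auto simp: AW free_vecs_def)
      moreover have "W *\<^sub>v v \<in> free_vecs n l"
        using mult_mat_vec_free_vecs[OF W _ v(1)] Wc by blast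
      ultimately have "r \<cdot>\<^sub>v v \<in> {v \<in> free_vecs n s. \<pi> v = \<zero>\<^bsub>M\<^esub>}"
        unfolding ker by (auto intro: rev_image_eqI)
      then show ?thesis using smult[OF rc v(1)] v(2) by simp
    qed
    then show "r \<in> annihilator (mpoly_ring n) M" using rc by (simp add: annihilator_def)
  qed
qed

section \<open>Determinants in the Fitting ideal\<close>

lemma ideal_sum_closed:
  assumes "ideal I (mpoly_ring n)" and "\<And>x. x \<in> F \<Longrightarrow> g x \<in> I"
  shows "sum g F \<in> I"
proof -
  interpret ideal I "mpoly_ring n" by fact
  show ?thesis
    using assms(2) additive_subgroup.zero_closed[OF is_additive_subgroup] additive_subgroup.a_closed[OF is_additive_subgroup]
    by (induction F rule: infinite_finite_induct) simp_all
qed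

lemma minors_closed:
  assumes "multigraded n A"
  shows "minors k A \<subseteq> carrier (mpoly_ring n)"
  using assms mpoly_ring_single_closed by (fastforce simp: multigraded_def is_term_def)

text \<open>Both sides of \<open>AW\<close> have the same determinant. On the right it is
  \<open>r ^ s\<close>; on the left it expands into determinants of column selections, each of which
  is zero or a maximal minor up to sign.\<close>

lemma power_in_Fitt0:
  fixes A :: "('k::field_char_0) mpoly mat"
  assumes A: "A \<in> carrier_mat s l" and graded: "multigraded n A"
    and W: "W \<in> carrier_mat l s" and W_closed: "\<forall>j<l. \<forall>i<s. W $$ (j, i) \<in> carrier (mpoly_ring n)"
    and AW: "A * W = r \<cdot>\<^sub>m 1\<^sub>m s"
  shows "r ^ s \<in> Fitt0 n A"
proof -
  interpret R: cring "mpoly_ring n :: 'k mpoly ring" by (rule mpoly_ring_cring)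
  have dim: "dim_row A = s" using A by simp
  have ideal: "ideal (Fitt0 n A) (mpoly_ring n)"
    unfolding Fitt0_def by (rule R.genideal_ideal[OF minors_closed[OF graded]])
  interpret I: ideal "Fitt0 n A" "mpoly_ring n" by (rule ideal)
  have minor: "m \<in> Fitt0 n A" if "m \<in> minors s A" for m
    using R.genideal_self[OF minors_closed[OF graded]] that by (auto simp: Fitt0_def dim)
  have "r ^ s = det (A * W)" by (simp add: AW)
  also have "\<dots> \<in> Fitt0 n A"
    unfolding det_mult_expand_columns[OF A W]
  proof (rule ideal_sum_closed[OF ideal])
    fix f assume f: "f \<in> {f. (\<forall>k\<in>{0..<s}. f k \<in> {0..<l}) \<and> (\<forall>k. k \<notin> {0..<s} \<longrightarrow> f k = k)}"
    let ?d = "det (mat s s (\<lambda>(i, k). A $$ (i, f k)))"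
    have prod: "(\<Prod>k=0..<s. W $$ (f k, k)) \<in> carrier (mpoly_ring n)"
      using f W_closed by (intro mpoly_ring_prod_closed) simp
    have "?d \<in> Fitt0 n A"
    proof (cases "inj_on f {0..<s}")
      case True
      have "f ` {0..<s} \<subseteq> {0..<l}" using f by blast
      from det_select_cols_minor[OF A this True] obtain m \<epsilon>
        where m: "m \<in> minors s A" and \<epsilon>: "\<epsilon> \<in> {1, - 1 :: 'k mpoly}" and eq: "?d = \<epsilon> * m" by blast
      have "\<epsilon> \<in> carrier (mpoly_ring n)" using \<epsilon> by (auto simp: mpoly_ring_closed)
      then show ?thesis using I.I_l_closed[OF minor[OF m]] eq by simp
    next
      case False
      then show ?thesis using I.zero_closed by (simp add: det_noninjective_columns)
    qed
    then show "(\<Prod>k=0..<s. W $$ (f k, k)) * ?d \<in> Fitt0 n A"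
      using I.I_l_closed[OF _ prod] by simp
  qed
  finally show ?thesis .
qed

text \<open>By the pigeonhole principle every selection of \<open>s\<close> among
  \<open>l < s\<close> columns repeats one, so each term of the expansion vanishes.\<close>

lemma det_mult_eq_zero:
  fixes A W :: "'a::comm_ring_1 mat"
  assumes A: "A \<in> carrier_mat s l" and W: "W \<in> carrier_mat l s" and "l < s"
  shows "det (A * W) = 0"
  unfolding det_mult_expand_columns[OF A W]
proof (rule sum.neutral, rule ballI)
  fix f assume f: "f \<in> {f. (\<forall>k\<in>{0..<s}. f k \<in> {0..<l}) \<and> (\<forall>k. k \<notin> {0..<s} \<longrightarrow> f k = k)}"
  have "\<not> inj_on f {0..<s}"
  proof
    assume "inj_on f {0..<s}"
    moreover have "f ` {0..<s} \<subseteq> {0..<l}" using f by blast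
    ultimately have "card {0..<s} \<le> card {0..<l}" by (rule card_inj_on_le) simp
    with \<open>l < s\<close> show False by simp
  qed
  then show "(\<Prod>k=0..<s. W $$ (f k, k)) * det (mat s s (\<lambda>(i, k). A $$ (i, f k))) = 0"
    by (simp add: det_noninjective_columns)
qed

section \<open>Maximal minors and their multidegrees\<close>

text \<open>A minor of size \<open>s\<close> uses all rows, and \<open>pick J\<close> enumerates its
  columns increasingly, so no sign appears.\<close>

lemma minors_full_rank_columns:
  assumes A: "A \<in> carrier_mat s l" and m: "m \<in> minors s A"
  obtains f where "f ` {0..<s} \<subseteq> {0..<l}" "inj_on f {0..<s}"
    "m = det (mat s s (\<lambda>(i, k). A $$ (i, f k)))"
proof -
  obtain I J where m: "m = det (submatrix A I J)" and I: "I \<subseteq> {..<s}" "card I = s"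
      and J: "J \<subseteq> {..<l}" "card J = s"
    using m A by (auto simp: minors_def)
  have I_eq: "I = {..<s}" using I by (simp add: card_subset_eq)
  have rows: "{i. i < s \<and> i \<in> I} = {..<s}" and cols: "{j. j < l \<and> j \<in> J} = J"
    using J by (auto simp: I_eq)
  have pick_id: "pick I i = i" if "i < s" for i
  proof -
    have "{a \<in> {..<s}. a < i} = {..<i}" using that by auto
    then show ?thesis using pick_card_in_set[of i "{..<s}"] that by (simp add: I_eq)
  qed
  have "submatrix A I J = mat s s (\<lambda>(i, k). A $$ (i, pick J k))"
    using A unfolding submatrix_def by (intro eq_matI) (simp_all add: rows cols J pick_id)
  moreover have "pick J ` {0..<s} \<subseteq> {0..<l}"
    using J pick_in_set_le[of _ J] by fastforce
  moreover have "inj_on (pick J) {0..<s}"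
  proof (rule inj_onI, rule ccontr)
    fix a b assume "a \<in> {0..<s}" "b \<in> {0..<s}" "pick J a = pick J b" "a \<noteq> b"
    then show False
      using pick_mono_le[of a J b] pick_mono_le[of b J a] J by (cases "a < b") auto
  qed
  ultimately show ?thesis using that[of "pick J"] m by simp
qed

text \<open>Every term of the Leibniz formula has the same multidegree, since the sum of the
  \<gamma> (p i) does not depend on the permutation \<open>p\<close>. The \<beta> i stand on the
  left so that no negative exponents arise.\<close>

lemma det_graded:
  fixes B :: "('k::field_char_0) mpoly mat"
  assumes B: "B \<in> carrier_mat s s"
    and graded: "\<And>i k. i < s \<Longrightarrow> k < s \<Longrightarrow>
      Poly_Mapping.single (\<beta> i) 1 * B $$ (i, k) = Poly_Mapping.single (\<gamma> k) (c i k)"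
  shows "Poly_Mapping.single (\<Sum>i=0..<s. \<beta> i) 1 * det B =
    Poly_Mapping.single (\<Sum>k=0..<s. \<gamma> k) (det (mat s s (\<lambda>(i, k). c i k)))"
proof -
  have single_prod: "(\<Prod>x\<in>F. Poly_Mapping.single (e x) (d x)) = Poly_Mapping.single (sum e F) (prod d F)"
    if "finite F" for F :: "nat set" and e :: "nat \<Rightarrow> nat \<Rightarrow>\<^sub>0 nat" and d :: "nat \<Rightarrow> 'k"
    using that by (induction F) (simp_all add: mult_single)
  have "Poly_Mapping.single (\<Sum>i=0..<s. \<beta> i) 1 * det B =
      (\<Sum>p | p permutes {0..<s}. signof p * (\<Prod>i=0..<s. Poly_Mapping.single (\<beta> i) 1 * B $$ (i, p i)))"
    unfolding det_def'[OF B] sum_distrib_left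
    by (intro sum.cong refl) (simp add: prod.distrib single_prod mult.left_commute)
  also have "\<dots> = (\<Sum>p | p permutes {0..<s}.
      Poly_Mapping.single (\<Sum>k=0..<s. \<gamma> k) (signof p * (\<Prod>i=0..<s. c i (p i))))"
  proof (intro sum.cong refl)
    fix p assume "p \<in> {p. p permutes {0..<s}}"
    then have p: "p permutes {0..<s}" by simp
    then have p_less: "p i < s" if "i < s" for i
      using permutes_in_image[OF p, of i] that by simp
    have "(\<Prod>i=0..<s. Poly_Mapping.single (\<beta> i) 1 * B $$ (i, p i)) =
        (\<Prod>i=0..<s. Poly_Mapping.single (\<gamma> (p i)) (c i (p i)))"
      using graded p_less by (intro prod.cong) auto
    also have "\<dots> = Poly_Mapping.single (\<Sum>i=0..<s. \<gamma> (p i)) (\<Prod>i=0..<s. c i (p i))"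
      by (simp add: single_prod)
    also have "(\<Sum>i=0..<s. \<gamma> (p i)) = (\<Sum>k=0..<s. \<gamma> k)"
      using sum.permute[OF p, of \<gamma>] by (simp add: comp_def)
    finally have "(\<Prod>i=0..<s. Poly_Mapping.single (\<beta> i) 1 * B $$ (i, p i)) =
        Poly_Mapping.single (\<Sum>k=0..<s. \<gamma> k) (\<Prod>i=0..<s. c i (p i))" .
    then show "signof p * (\<Prod>i=0..<s. Poly_Mapping.single (\<beta> i) 1 * B $$ (i, p i)) =
        Poly_Mapping.single (\<Sum>k=0..<s. \<gamma> k) (signof p * (\<Prod>i=0..<s. c i (p i)))"
      \<comment> \<open>The sign is an integer, hence a term with exponent 0, and is absorbed into
        the coefficient.\<close>
      by (simp only: single_of_int[symmetric] mult_single add_0)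
  qed
  also have "\<dots> = Poly_Mapping.single (\<Sum>k=0..<s. \<gamma> k)
      (\<Sum>p | p permutes {0..<s}. signof p * (\<Prod>i=0..<s. c i (p i)))"
    by (intro poly_mapping_eqI) (simp add: lookup_sum lookup_single when_def)
  also have "(\<Sum>p | p permutes {0..<s}. signof p * (\<Prod>i=0..<s. c i (p i))) =
      det (mat s s (\<lambda>(i, k). c i k))"
    unfolding det_def'[OF mat_carrier]
  proof (intro sum.cong refl arg_cong2[where f = "(*)"] prod.cong)
    fix p i assume "p \<in> {p. p permutes {0..<s}}" "i \<in> {0..<s}"
    then show "c i (p i) = mat s s (\<lambda>(i, k). c i k) $$ (i, p i)"
      using permutes_in_image[of p "{0..<s}" i] by simp
  qed
  finally show ?thesis .
qed

section \<open>Monomials of elements of the radical\<close>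

text \<open>Otherwise setting the variables outside \<alpha> to 0 kills every maximal minor, hence
  \<open>Fitt0 n A\<close>, hence a power of \<open>p\<close> and \<open>p\<close> itself; but the
  term of \<open>p\<close> at \<alpha> survives.\<close>

lemma radical_Fitt0_keys:
  fixes A :: "('k::field_char_0) mpoly mat"
  assumes graded: "multigraded n A" and p: "p \<in> radical (mpoly_ring n) (Fitt0 n A)"
    and \<alpha>: "\<alpha> \<in> Poly_Mapping.keys p"
  shows "\<exists>\<delta> d. d \<noteq> 0 \<and> Poly_Mapping.single \<delta> d \<in> minors (dim_row A) A \<and>
    Poly_Mapping.keys \<delta> \<subseteq> Poly_Mapping.keys \<alpha>"
proof (rule ccontr)
  assume none: "\<not> ?thesis"
  interpret R: cring "mpoly_ring n :: 'k mpoly ring" by (rule mpoly_ring_cring)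
  define T where "T = {\<kappa> :: nat \<Rightarrow>\<^sub>0 nat. Poly_Mapping.keys \<kappa> \<subseteq> Poly_Mapping.keys \<alpha>}"
  have T: "\<kappa> + \<mu> \<in> T \<longleftrightarrow> \<kappa> \<in> T \<and> \<mu> \<in> T" for \<kappa> \<mu>
    by (auto simp: T_def subset_iff in_keys_iff lookup_add)
  have T0: "0 \<in> T" by (simp add: T_def)
  let ?K = "{q \<in> carrier (mpoly_ring n). restrict_to T q = 0}"
  have "minors (dim_row A) A \<subseteq> ?K"
  proof
    fix m assume m: "m \<in> minors (dim_row A) A"
    then obtain \<delta> d where md: "m = Poly_Mapping.single \<delta> d"
      using graded unfolding multigraded_def is_term_def by metis
    have "restrict_to T m = 0"
      using none m by (cases "d = 0") (auto simp: md restrict_to_single T_def)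
    then show "m \<in> ?K" using minors_closed[OF graded] m by blast
  qed
  then have Fitt0: "Fitt0 n A \<subseteq> ?K"
    unfolding Fitt0_def by (rule R.genideal_minimal[OF restrict_to_kernel_ideal[OF T]])
  obtain e :: nat where "p ^ e \<in> Fitt0 n A" using p by (auto simp: radical_def)
  then have "restrict_to T p ^ e = 0"
    using Fitt0 by (auto simp: restrict_to_power[OF T T0, symmetric])
  \<comment> \<open>Polynomials have no nilpotents other than 0.\<close>
  then have "restrict_to T p = 0" by (simp add: power_eq_0_iff)
  moreover have "Poly_Mapping.lookup (restrict_to T p) \<alpha> \<noteq> 0"
    using \<alpha> by (simp add: lookup_restrict_to T_def in_keys_iff)
  ultimately show False by simp
qed

text \<open>Under uniform rank this makes every entry nonzero, so that the system E_A has an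
  equation for every pair (i, j).\<close>

lemma entry_in_minors:
  assumes "A \<in> carrier_mat s l" "i < s" "j < l"
  shows "A $$ (i, j) \<in> minors 1 A"
proof -
  have rows: "{i'. i' < s \<and> i' = i} = {i}" and cols: "{j'. j' < l \<and> j' = j} = {j}"
    using assms by auto
  have "submatrix A {i} {j} \<in> carrier_mat 1 1"
    using assms by (intro carrier_matI) (simp_all add: dim_submatrix rows cols)
  then have "det (submatrix A {i} {j}) = submatrix A {i} {j} $$ (0, 0)"
    by (simp add: det_single)
  also have "\<dots> = A $$ (i, j)"
  proof -
    have "{a \<in> {i}. a < i} = {}" "{a \<in> {j}. a < j} = {}" by auto
    then have "card {a \<in> {i}. a < i} = 0" "card {a \<in> {j}. a < j} = 0" by simp_all
    then show ?thesis
      using submatrix_index_card[of i A j "{i}" "{j}"] assms by (metis carrier_matD singletonI)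
  qed
  finally show ?thesis using assms
    unfolding minors_def by (intro CollectI exI[of _ "{i}"] exI[of _ "{j}"]) auto
qed

text \<open>Meant for the exponents of a single variable: \<open>b i\<close> in x^(\<beta> i),
  \<open>g k\<close> in x^(\<gamma> (f k)) and \<open>\<delta>\<close> in the minor. If
  \<open>\<delta>\<close> were 0, the equal sums and \<open>b x \<le> g x\<close> would force
  \<open>b x = g x\<close> for all \<open>x\<close>. Then \<open>g k = b k \<le> g i = b i\<close>,
  against the gap.\<close>

lemma binary_gap_sum:
  fixes b g :: "nat \<Rightarrow> nat"
  assumes le: "\<And>i k. i < s \<Longrightarrow> k < s \<Longrightarrow> b i \<le> g k"
    and g: "\<And>k. k < s \<Longrightarrow> g k \<le> 1"
    and sum: "(\<Sum>i=0..<s. b i) + \<delta> = (\<Sum>k=0..<s. g k)"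
    and ik: "i < s" "k < s" "b i < g k"
  shows "0 < \<delta>"
proof (rule ccontr)
  assume "\<not> 0 < \<delta>"
  then have eq: "b x = g x" if "x < s" for x
    using that le sum by (intro sum_mono_inv[of b "{0..<s}" g]) auto
  show False using le[of k i] eq[of i] eq[of k] ik by simp
qed

text \<open>Supplies the hypotheses of \<open>monomial_multiple_of_identity\<close>: the grading
  comes from a 0-1 solution of E_A, the invertible scalar matrix from the nonzero minor, and the
  exponent bound from \<open>binary_gap_sum\<close>.\<close>

lemma monomial_above_minor_multiple_of_identity:
  fixes A :: "('k::field_char_0) mpoly mat"
  assumes A: "A \<in> carrier_mat s l" and graded: "multigraded n A"
    and sqfree: "squarefree_matrix n A" and rank: "uniform_rank A"
    and minor: "Poly_Mapping.single \<delta> d \<in> minors s A"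
    and \<delta>\<alpha>: "Poly_Mapping.keys \<delta> \<subseteq> Poly_Mapping.keys \<alpha>" and \<alpha>: "\<alpha> \<in> exponents n"
  shows "\<exists>W \<in> carrier_mat l s. (\<forall>j<l. \<forall>i<s. W $$ (j, i) \<in> carrier (mpoly_ring n)) \<and>
    A * W = Poly_Mapping.single \<alpha> 1 \<cdot>\<^sub>m 1\<^sub>m s"
proof -
  have dims: "dim_row A = s" "dim_col A = l" using A by auto
  obtain \<gamma> \<beta> where solves: "solves_E n A \<gamma> \<beta>"
    and \<gamma>: "\<And>j v. j < l \<Longrightarrow> v < n \<Longrightarrow> \<gamma> j v \<in> {0, 1}"
    and \<beta>: "\<And>i v. i < s \<Longrightarrow> v < n \<Longrightarrow> \<beta> i v \<in> {0, 1}"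
    using sqfree unfolding squarefree_matrix_def dims by auto
  \<comment> \<open>Turns an integer solution vector into an exponent, ignoring its values at
    indices from \<open>n\<close> on, which the system leaves free.\<close>
  define expo where "expo u = (\<Sum>v<n. Poly_Mapping.single v (nat (u v)))" for u
  have expo: "Poly_Mapping.lookup (expo u) v = (if v < n then nat (u v) else 0)" for u v
    by (simp add: expo_def lookup_sum lookup_single when_def)
  have expo_closed: "expo u \<in> exponents n" for u
    by (auto simp: exponents_def in_keys_iff expo split: if_splits)
  have "\<exists>a c. a \<in> exponents n \<and> c \<noteq> 0 \<and> A $$ (i, j) = Poly_Mapping.single a c" if "i < s" "j < l" for i j
  proof -
    have "A $$ (i, j) \<noteq> 0"
      using rank entry_in_minors[OF A that] by (auto simp: uniform_rank_def)
    moreover have "is_term n (A $$ (i, j))" using graded that by (simp add: multigraded_def dims)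
    ultimately show ?thesis unfolding is_term_def by (metis single_zero)
  qed
  then obtain a c where ac: "\<And>i j. i < s \<Longrightarrow> j < l \<Longrightarrow> a i j \<in> exponents n"
      "\<And>i j. i < s \<Longrightarrow> j < l \<Longrightarrow> c i j \<noteq> 0"
      "\<And>i j. i < s \<Longrightarrow> j < l \<Longrightarrow> A $$ (i, j) = Poly_Mapping.single (a i j) (c i j)"
    by metis
  have shift: "expo (\<beta> i) + a i j = expo (\<gamma> j)" if ij: "i < s" "j < l" for i j
  proof (rule poly_mapping_eqI)
    fix v
    show "Poly_Mapping.lookup (expo (\<beta> i) + a i j) v = Poly_Mapping.lookup (expo (\<gamma> j)) v"
    proof (cases "v < n")
      case True
      have "\<gamma> j v - \<beta> i v = int (Poly_Mapping.lookup (a i j) v)"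
        using solves ij ac[OF ij] True unfolding solves_E_def dims by blast
      then show ?thesis using True \<beta>[OF ij(1) True] by (auto simp: lookup_add expo)
    next
      case False
      then have "v \<notin> Poly_Mapping.keys (a i j)" using ac(1)[OF ij] by (auto simp: exponents_def)
      then show ?thesis using False by (simp add: lookup_add expo in_keys_iff)
    qed
  qed
  have entry: "Poly_Mapping.single (expo (\<beta> i)) 1 * A $$ (i, j) = Poly_Mapping.single (expo (\<gamma> j)) (c i j)"
    if "i < s" "j < l" for i j
    using that by (simp add: ac(3) mult_single shift)
  obtain f where f: "f ` {0..<s} \<subseteq> {0..<l}" and inj: "inj_on f {0..<s}"
    and B: "Poly_Mapping.single \<delta> d = det (mat s s (\<lambda>(i, k). A $$ (i, f k)))"
    using minors_full_rank_columns[OF A minor] by blast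
  have f_less: "f k < l" if "k < s" for k using f that by (auto simp: image_subset_iff)
  have "Poly_Mapping.single \<delta> d \<noteq> 0"
    using rank minor unfolding uniform_rank_def by blast
  then have d: "d \<noteq> 0" by auto
  have "Poly_Mapping.single (\<Sum>i=0..<s. expo (\<beta> i)) 1 * Poly_Mapping.single \<delta> d =
      Poly_Mapping.single (\<Sum>k=0..<s. expo (\<gamma> (f k))) (det (mat s s (\<lambda>(i, k). c i (f k))))"
    unfolding B by (rule det_graded) (simp_all add: entry f_less)
  then have eq: "Poly_Mapping.single ((\<Sum>i=0..<s. expo (\<beta> i)) + \<delta>) d =
      Poly_Mapping.single (\<Sum>k=0..<s. expo (\<gamma> (f k))) (det (mat s s (\<lambda>(i, k). c i (f k))))"
    by (simp add: mult_single)
  \<comment> \<open>Comparing coefficients in \<open>eq\<close> gives the nonzero determinant,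
    comparing exponents gives \<open>degrees\<close>.\<close>
  then have det: "det (mat s s (\<lambda>(i, k). c i (f k))) \<noteq> 0"
    using d by (metis keys_single single_zero insert_not_empty)
  have degrees: "(\<Sum>i=0..<s. expo (\<beta> i)) + \<delta> = (\<Sum>k=0..<s. expo (\<gamma> (f k)))"
    using arg_cong[OF eq, of Poly_Mapping.keys] d det by simp
  show ?thesis
  proof (rule monomial_multiple_of_identity[OF A entry f inj det _ \<alpha> expo_closed])
    fix i k v assume ik: "i < s" "k < s"
    let ?b = "\<lambda>i. Poly_Mapping.lookup (expo (\<beta> i)) v"
    let ?g = "\<lambda>k. Poly_Mapping.lookup (expo (\<gamma> (f k))) v"
    have g_le: "?g k \<le> 1" if "k < s" for k
      using \<gamma>[OF f_less[OF that], of v] by (auto simp: expo)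
    show "?g k \<le> Poly_Mapping.lookup \<alpha> v + ?b i"
    \<comment> \<open>Only a gap needs an argument: it puts the variable \<open>v\<close> into the
      minor, hence into \<alpha>, and the exponent 1 there suffices because
      \<open>?g k \<le> 1\<close>.\<close>
    proof (cases "?b i < ?g k")
      case True
      have "?b i' \<le> ?g k'" if "i' < s" "k' < s" for i' k'
        using shift[OF that(1) f_less[OF that(2)]] by (metis lookup_add le_add1)
      moreover have "(\<Sum>i=0..<s. ?b i) + Poly_Mapping.lookup \<delta> v = (\<Sum>k=0..<s. ?g k)"
        using arg_cong[OF degrees, of "\<lambda>e. Poly_Mapping.lookup e v"] by (simp add: lookup_add lookup_sum)
      ultimately have "0 < Poly_Mapping.lookup \<delta> v"
        using g_le ik True by (intro binary_gap_sum[of s ?b ?g]) auto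
      then have "Poly_Mapping.lookup \<alpha> v \<noteq> 0"
        using \<delta>\<alpha> by (auto simp: in_keys_iff subset_iff)
      then show ?thesis using g_le[OF ik(2)] by simp
    qed simp
  qed
qed

theorem proposition2p11:
  fixes n s l :: nat
    and A :: "('k::field_char_0) mpoly mat"
    and M :: "('k mpoly, 'm) module"
  assumes "A \<in> carrier_mat s l"
    and "multigraded n A"
    and "squarefree_matrix n A"
    and "uniform_rank A"
    and "module (mpoly_ring n) M"
    and "presentation_matrix n A M"
  shows "(l < s \<longrightarrow> annihilator (mpoly_ring n) M = {\<zero>\<^bsub>mpoly_ring n\<^esub>}) \<and>
    (\<not> l < s \<longrightarrow> annihilator (mpoly_ring n) M = radical (mpoly_ring n) (Fitt0 n A))"
proof -
  note A = assms(1)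
  note ann_iff = annihilator_iff_multiple_of_identity[OF A assms(5,6)]
  have dim: "dim_row A = s" using A by simp
  interpret R: cring "mpoly_ring n :: 'k mpoly ring" by (rule mpoly_ring_cring)
  have "annihilator (mpoly_ring n) M = {0}" if "l < s"
  proof (intro equalityI subsetI)
    fix r assume "r \<in> annihilator (mpoly_ring n) M"
    then obtain W where W: "W \<in> carrier_mat l s" and AW: "A * W = r \<cdot>\<^sub>m 1\<^sub>m s"
      using ann_iff by blast
    \<comment> \<open>This determinant vanishes, and in a domain \<open>r ^ s = 0\<close> forces
      \<open>r = 0\<close>.\<close>
    have "r ^ s = det (A * W)" by (simp add: AW)
    then show "r \<in> {0}" using det_mult_eq_zero[OF A W that] by simp
  next
    fix r :: "'k mpoly" assume "r \<in> {0}"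
    then show "r \<in> annihilator (mpoly_ring n) M"
      using module.smult_l_null[OF assms(5)] by (simp add: annihilator_def mpoly_ring_closed)
  qed
  moreover have "annihilator (mpoly_ring n) M = radical (mpoly_ring n) (Fitt0 n A)"
  proof (intro equalityI subsetI)
    fix r assume "r \<in> annihilator (mpoly_ring n) M"
    then obtain W where r: "r \<in> carrier (mpoly_ring n)" and W: "W \<in> carrier_mat l s"
      and Wc: "\<forall>j<l. \<forall>i<s. W $$ (j, i) \<in> carrier (mpoly_ring n)" and AW: "A * W = r \<cdot>\<^sub>m 1\<^sub>m s"
      using ann_iff by blast
    have ideal: "ideal (Fitt0 n A) (mpoly_ring n)"
      unfolding Fitt0_def by (rule R.genideal_ideal[OF minors_closed[OF assms(2)]])
    \<comment> \<open>One more factor \<open>r\<close>, because \<open>radical\<close> asks for a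
      positive exponent and \<open>s\<close> may be 0.\<close>
    have "r ^ Suc s \<in> Fitt0 n A"
      using ideal.I_l_closed[OF ideal power_in_Fitt0[OF A assms(2) W Wc AW] r] by simp
    then show "r \<in> radical (mpoly_ring n) (Fitt0 n A)"
      unfolding radical_def using r by (intro CollectI conjI exI[of _ "Suc s"]) (simp_all add: mult.commute)
  next
    fix p assume p: "p \<in> radical (mpoly_ring n) (Fitt0 n A)"
    then have pc: "p \<in> carrier (mpoly_ring n)" by (simp add: radical_def)
    have "\<exists>W \<in> carrier_mat l s. (\<forall>j<l. \<forall>i<s. W $$ (j, i) \<in> carrier (mpoly_ring n)) \<and>
        A * W = p \<cdot>\<^sub>m 1\<^sub>m s"
    proof (rule multiple_of_identity_from_monomials[OF A pc])
      fix \<alpha> assume \<alpha>: "\<alpha> \<in> Poly_Mapping.keys p"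
      then have "\<alpha> \<in> exponents n" using pc by (auto simp: carrier_mpoly_ring_iff)
      moreover obtain \<delta> d where "Poly_Mapping.single \<delta> d \<in> minors s A"
          "Poly_Mapping.keys \<delta> \<subseteq> Poly_Mapping.keys \<alpha>"
        using radical_Fitt0_keys[OF assms(2) p \<alpha>] unfolding dim by blast
      ultimately show "\<exists>W \<in> carrier_mat l s. (\<forall>j<l. \<forall>i<s. W $$ (j, i) \<in> carrier (mpoly_ring n)) \<and>
          A * W = Poly_Mapping.single \<alpha> 1 \<cdot>\<^sub>m 1\<^sub>m s"
        using monomial_above_minor_multiple_of_identity[OF A assms(2-4)] by blast
    qed
    then show "p \<in> annihilator (mpoly_ring n) M" using ann_iff pc by blast
  qed
  ultimately show ?thesis by simp
qed

end
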